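(* Let $d\ge 2$ and $N\ge 1$ be integers. The optimal (worst-case) fidelity $F^*_{\mathrm{EPR}}$ achievable by a deterministic Port-Based State Preparation protocol for $d$-dimensional states with $N$ ports and with $N$ maximally entangled resource states satisfies $$F^*_{\mathrm{EPR}}\le 1-\left(1-\frac1d\right)^N .$$
   Context: Deterministic Port-Based State Preparation (PBSP) with maximally entangled resource. Alice holds $N$ qudits $A=A_1\cdots A_N$ and Bob holds $N$ qudits $B=B_1\cdots B_N$ (each register is a copy of $\mathbb{C}^d$). They share the resource state $\rho_{AB}=\bigotimes_{i=1}^N|\phi_d^+\rangle\langle\phi_d^+|_{A_iB_i}$, where $|\phi_d^+\rangle=\frac1{\sqrt d}\sum_{x=1}^d|x\rangle\otimes|x\rangle$. The input is the complete (arbitrarily precise) classical description $\psi$ of a pure state $|\psi\rangle\in\mathbb{C}^d$, known to Alice only. Alice performs on $A$ an $N$-outcome POVM $\{M_x(\psi)\}_{x=1}^N$, which may depend on $\psi$, and sends the outcome $x\in\{1,\dots,N\}$ to Bob. Bob traces out all of his registers except $B_x$ (the "port"). The output of the protocol on input $\psi$ is the state on $\mathbb{C}^d$ $$\Phi(\psi) = \sum_{x=1}^N \mathrm{Tr}_{A B_{\bar x}}\big[(M_x(\psi)\otimes I_B)\rho_{AB}\big],$$ where $B_{\bar x}$ denotes all of Bob's registers other than $B_x$, and each $B_x$ is identified with $\mathbb{C}^d$. The worst-case fidelity of the protocol is $F_{\mathrm{wc}}(\Phi) = \inf_{|\psi\rangle}\langle\psi|\Phi(\psi)|\psi\rangle$,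 the infimum over unit vectors of $\mathbb{C}^d$. $F^*_{\mathrm{EPR}}$ is the supremum of $F_{\mathrm{wc}}(\Phi)$ over all choices of POVMs $\{M_x(\psi)\}_x$ with this maximally entangled resource. *)

theory Defs
  imports "HOL-Analysis.Analysis"
begin

text \<open>
  The qudit space \<open>\<complex>\<^sup>d\<close> is \<open>complex ^ 'd\<close> with \<open>d = CARD('d)\<close>, and the ports are the elements
  of the finite type \<open>'n\<close>, so that \<open>N = CARD('n)\<close>.  The computational basis of the \<open>N\<close>-qudit space
  is the set of all functions \<open>a :: 'n \<Rightarrow> 'd\<close>, where \<open>a i\<close> is the basis label of the \<open>i\<close>-th qudit;
  hence \<open>(\<complex>\<^sup>d)\<^sup>\<otimes>\<^sup>N\<close> is \<open>complex ^ ('n \<Rightarrow> 'd)\<close>.  A bipartite system has basis labels in a product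
  type.  A square matrix \<open>X :: complex ^ 'i ^ 'i\<close> has the entry \<open>X $ i $ j\<close> in row \<open>i\<close> and
  column \<open>j\<close>.
\<close>

type_synonym 'i cmat = "complex ^ 'i ^ 'i"

definition ketbra :: "complex ^ 'i \<Rightarrow> 'i::finite cmat" where
  "ketbra v = (\<chi> i j. v $ i * cnj (v $ j))"

text \<open>The sesquilinear form \<open>\<langle>v|X|v\<rangle>\<close>; note that the library's \<open>\<bullet>\<close> on \<open>complex ^ 'i\<close> is only
  the real part of the Hermitian inner product.\<close>

definition expect :: "'i::finite cmat \<Rightarrow> complex ^ 'i \<Rightarrow> complex" where
  "expect X v = (\<Sum>i\<in>UNIV. cnj (v $ i) * (X *v v) $ i)"

definition psd :: "'i::finite cmat \<Rightarrow> bool" where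
  "psd X \<longleftrightarrow> (\<forall>v. expect X v \<in> \<real>\<^sub>\<ge>\<^sub>0)"

definition povm :: "('n::finite \<Rightarrow> 'i::finite cmat) \<Rightarrow> bool" where
  "povm M \<longleftrightarrow> (\<forall>x. psd (M x)) \<and> (\<Sum>x\<in>UNIV. M x) = mat 1"

definition tensor :: "'i::finite cmat \<Rightarrow> 'j::finite cmat \<Rightarrow> ('i \<times> 'j) cmat" where
  "tensor X Y = (\<chi> p q. X $ fst p $ fst q * Y $ snd p $ snd q)"

definition max_ent :: "complex ^ ('d::finite \<times> 'd)" where
  "max_ent = (\<chi> p. if fst p = snd p then 1 / complex_of_real (sqrt (real CARD('d))) else 0)"

text \<open>The resource \<open>\<Otimes>\<^sub>i |\<phi>\<^sub>d\<^sup>+\<rangle>\<langle>\<phi>\<^sub>d\<^sup>+|\<close>, with the \<open>i\<close>-th factor acting on \<open>A\<^sub>i B\<^sub>i\<close>; the tensor factors are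
  reordered so that all of \<open>A\<close> comes before all of \<open>B\<close>.\<close>

definition epr_resource :: "(('n::finite \<Rightarrow> 'd::finite) \<times> ('n \<Rightarrow> 'd)) cmat" where
  "epr_resource = (\<chi> p q. \<Prod>i\<in>UNIV.
     ketbra max_ent $ (fst p i, snd p i) $ (fst q i, snd q i))"

text \<open>The partial trace over \<open>A\<close> and all of \<open>B\<close> except \<open>B\<^sub>x\<close>.  The row label \<open>b\<close> of \<open>B\<close> ranges over
  the labels whose \<open>x\<close>-th entry is \<open>j\<close>; the column label agrees with it off \<open>x\<close> and is \<open>k\<close> at \<open>x\<close>.\<close>

definition ptrace_to_port ::
  "'n \<Rightarrow> (('n::finite \<Rightarrow> 'd::finite) \<times> ('n \<Rightarrow> 'd)) cmat \<Rightarrow> 'd cmat" where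
  "ptrace_to_port x X =
     (\<chi> j k. \<Sum>a\<in>UNIV. \<Sum>b\<in>{b. b x = j}. X $ (a, b) $ (a, b(x := k)))"

text \<open>A strategy assigns to the description of a unit vector the measurement that Alice performs;
  its values at other vectors are irrelevant.  The measurements for \<open>\<psi>\<close> and \<open>c \<psi>\<close> with \<open>\<bar>c\<bar> = 1\<close> may
  differ, which does not affect the optimum.\<close>

type_synonym ('n, 'd) strategy = "complex ^ 'd \<Rightarrow> 'n \<Rightarrow> ('n \<Rightarrow> 'd) cmat"

definition pbsp_strategies :: "('n::finite, 'd::finite) strategy set" where
  "pbsp_strategies = {M. \<forall>\<psi>. norm \<psi> = 1 \<longrightarrow> povm (M \<psi>)}"

definition pbsp_output :: "('n::finite, 'd::finite) strategy \<Rightarrow> complex ^ 'd \<Rightarrow> 'd cmat" where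
  "pbsp_output M \<psi> =
     (\<Sum>x\<in>UNIV. ptrace_to_port x (tensor (M \<psi> x) (mat 1) ** epr_resource))"

text \<open>The fidelity of a strategy at a unit vector is a real number in \<open>{0..1}\<close>, and there are both
  unit vectors and strategies, so the infimum and supremum below are over nonempty bounded sets.\<close>

definition worst_case_fidelity :: "(complex ^ 'd \<Rightarrow> 'd::finite cmat) \<Rightarrow> real" where
  "worst_case_fidelity \<Phi> = (INF \<psi>\<in>{\<psi>. norm \<psi> = 1}. Re (expect (\<Phi> \<psi>) \<psi>))"

definition optimal_fidelity_epr :: "'n::finite itself \<Rightarrow> 'd::finite itself \<Rightarrow> real" where
  "optimal_fidelity_epr _ _ =
     (SUP M\<in>(pbsp_strategies :: ('n, 'd) strategy set). worst_case_fidelity (pbsp_output M))"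

end

theory Submission imports Defs begin

text \<open>
  Already a single computational basis state \<open>e\<^sub>z\<close> is hard to prepare.  On the maximally entangled
  resource, the fidelity at \<open>e\<^sub>z\<close> is \<open>d\<^sup>-\<^sup>N\<close> times the sum, over ports \<open>x\<close> and strings \<open>b\<close> with
  \<open>b\<^sub>x = z\<close>, of the diagonal entry of \<open>M\<^sub>x\<close> at \<open>b\<close>.  These entries are nonnegative and add up to \<open>1\<close>
  over \<open>x\<close>, so a string \<open>b\<close> contributes at most \<open>1\<close>, and nothing unless \<open>z\<close> occurs in it; exactly
  \<open>d\<^sup>N - (d-1)\<^sup>N\<close> strings contain \<open>z\<close>.
\<close>

lemma expect_eq_sum:
  "expect X v = (\<Sum>i\<in>UNIV. \<Sum>j\<in>UNIV. cnj (v $ i) * X $ i $ j * v $ j)"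
  by (simp add: expect_def matrix_vector_mult_def sum_distrib_left mult.assoc)

lemma expect_sum: "expect (\<Sum>x\<in>A. X x) v = (\<Sum>x\<in>A. expect (X x) v)"
proof -
  have "(\<Sum>x\<in>A. expect (X x) v) =
      (\<Sum>i\<in>UNIV. \<Sum>j\<in>UNIV. \<Sum>x\<in>A. cnj (v $ i) * X x $ i $ j * v $ j)"
    unfolding expect_eq_sum by (subst sum.swap, rule sum.cong[OF refl], rule sum.swap)
  then show ?thesis
    by (simp add: expect_eq_sum sum_distrib_left sum_distrib_right)
qed

lemma expect_axis: "expect X (axis z 1) = X $ z $ z"
proof -
  have "expect X (axis z 1) = (\<Sum>i\<in>UNIV. \<Sum>j\<in>UNIV. if j = z then if i = z then X $ i $ j else 0 else 0)"
    unfolding expect_eq_sum by (intro sum.cong refl) (simp add: axis_def)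
  then show ?thesis by simp
qed

lemma expect_mat_1: "expect (mat 1) v = complex_of_real (\<Sum>i\<in>UNIV. (norm (v $ i))\<^sup>2)"
  by (simp add: expect_def complex_norm_square mult.commute del: of_real_power)

lemma psd_mat_1: "psd (mat 1)"
  by (simp add: psd_def expect_mat_1 nonneg_Reals_of_real_iff sum_nonneg del: of_real_sum)

lemma psd_0: "psd 0"
  by (simp add: psd_def expect_def)

lemma psd_Re_expect_nonneg: "psd X \<Longrightarrow> 0 \<le> Re (expect X v)"
  by (simp add: psd_def complex_nonneg_Reals_iff)

text \<open>Bounding the supremum by a common upper bound requires a nonempty family. The witness
  ignores its input and always announces port \<open>x0\<close>.\<close>

lemma pbsp_strategies_nonempty:
  "(pbsp_strategies :: ('n::finite, 'd::finite) strategy set) \<noteq> {}"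
proof -
  fix x0 :: 'n
  have "(\<lambda>_ x. if x = x0 then mat 1 else 0) \<in> (pbsp_strategies :: ('n, 'd) strategy set)"
    by (simp add: pbsp_strategies_def povm_def psd_mat_1 psd_0)
  then show ?thesis by blast
qed

text \<open>Two amplitudes 1/sqrt(d) per port give 1/d, and a single mismatched port makes the
  product vanish. Up to scale this is the projector onto the sum of all |a>|a>.\<close>

lemma epr_resource_nth:
  fixes a b a' b' :: "'n::finite \<Rightarrow> 'd::finite"
  shows "epr_resource $ (a, b) $ (a', b') =
    (if a = b \<and> a' = b' then 1 / of_nat CARD('d) ^ CARD('n) else 0)"
proof -
  have sq: "complex_of_real (sqrt (real CARD('d))) * complex_of_real (sqrt (real CARD('d)))
      = of_nat CARD('d)"
    by (simp flip: of_real_mult)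
  have "epr_resource $ (a, b) $ (a', b') =
      (\<Prod>i\<in>(UNIV::'n set). if a i = b i \<and> a' i = b' i then 1 / complex_of_nat CARD('d) else 0)"
    unfolding epr_resource_def by (auto simp: ketbra_def max_ent_def sq intro!: prod.cong)
  also have "\<dots> = (if a = b \<and> a' = b' then 1 / of_nat CARD('d) ^ CARD('n) else 0)"
    by (auto simp: power_one_over fun_eq_iff)
  finally show ?thesis .
qed

text \<open>The transpose trick: the identity on B and the perfect correlation of the resource force
  the summed label of A to equal \<open>b\<close>, which thereby becomes the column index of
  \<open>X\<close>.\<close>

lemma tensor_mat_1_epr_resource_nth:
  fixes X :: "('n::finite \<Rightarrow> 'd::finite) cmat"
  shows "(tensor X (mat 1) ** epr_resource) $ (a, b) $ (a', b') =
    (if a' = b' then X $ a $ b / of_nat CARD('d) ^ CARD('n) else 0)"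
proof -
  have "(tensor X (mat 1) ** epr_resource) $ (a, b) $ (a', b') =
      (\<Sum>p\<in>UNIV \<times> UNIV. X $ a $ fst p * (if b = snd p then 1 else 0) *
         epr_resource $ (fst p, snd p) $ (a', b'))"
    by (simp add: matrix_matrix_mult_def tensor_def mat_def)
  also have "\<dots> = (\<Sum>c\<in>UNIV. \<Sum>e\<in>UNIV. if e = b then X $ a $ c *
         epr_resource $ (c, e) $ (a', b') else 0)"
    unfolding sum.cartesian_product by (intro sum.cong refl) auto
  also have "\<dots> = (\<Sum>c\<in>UNIV. if c = b then (if a' = b' then X $ a $ b / of_nat CARD('d) ^ CARD('n) else 0) else 0)"
    by (simp only: sum.delta finite UNIV_I if_True) (auto simp: epr_resource_nth if_distrib[of "(*) _"] cong: if_cong)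
  finally show ?thesis by simp
qed

text \<open>Tracing out A ties its label to the column string \<open>b(x := k)\<close>. Hence port
  \<open>x\<close> carries the marginal of the transpose of \<open>X\<close>, scaled by
  d^-N.\<close>

lemma ptrace_to_port_epr_resource_nth:
  fixes X :: "('n::finite \<Rightarrow> 'd::finite) cmat"
  shows "ptrace_to_port x (tensor X (mat 1) ** epr_resource) $ j $ k =
    (\<Sum>b | b x = j. X $ (b(x := k)) $ b) / of_nat CARD('d) ^ CARD('n)"
proof -
  have "ptrace_to_port x (tensor X (mat 1) ** epr_resource) $ j $ k =
      (\<Sum>a\<in>UNIV. \<Sum>b | b x = j. if a = b(x := k)
         then X $ a $ b / of_nat CARD('d) ^ CARD('n) else 0)"
    by (simp add: ptrace_to_port_def tensor_mat_1_epr_resource_nth)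
  also have "\<dots> = (\<Sum>b | b x = j. \<Sum>a\<in>UNIV. if a = b(x := k)
         then X $ a $ b / of_nat CARD('d) ^ CARD('n) else 0)"
    by (rule sum.swap)
  also have "\<dots> = (\<Sum>b | b x = j. X $ (b(x := k)) $ b) / of_nat CARD('d) ^ CARD('n)"
    by (simp add: sum_divide_distrib)
  finally show ?thesis .
qed

lemma expect_ptrace_to_port_epr_resource:
  fixes X :: "('n::finite \<Rightarrow> 'd::finite) cmat"
  shows "expect (ptrace_to_port x (tensor X (mat 1) ** epr_resource)) \<psi> =
    (\<Sum>b\<in>UNIV. \<Sum>k\<in>UNIV. cnj (\<psi> $ b x) * X $ (b(x := k)) $ b * \<psi> $ k)
      / of_nat CARD('d) ^ CARD('n)"
proof -
  let ?D = "of_nat CARD('d) ^ CARD('n) :: complex"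
  have "expect (ptrace_to_port x (tensor X (mat 1) ** epr_resource)) \<psi> =
      (\<Sum>j\<in>UNIV. \<Sum>k\<in>UNIV. \<Sum>b | b x = j. cnj (\<psi> $ b x) * X $ (b(x := k)) $ b * \<psi> $ k / ?D)"
    unfolding expect_eq_sum ptrace_to_port_epr_resource_nth
    by (intro sum.cong refl)
       (simp add: sum_distrib_left sum_distrib_right sum_divide_distrib)
  also have "\<dots> = (\<Sum>j\<in>UNIV. \<Sum>b | b x = j. \<Sum>k\<in>UNIV. cnj (\<psi> $ b x) * X $ (b(x := k)) $ b * \<psi> $ k / ?D)"
    by (intro sum.cong refl sum.swap)
  also have "\<dots> = (\<Sum>b\<in>UNIV. \<Sum>k\<in>UNIV. cnj (\<psi> $ b x) * X $ (b(x := k)) $ b * \<psi> $ k / ?D)"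
    using sum.group[of "UNIV :: ('n \<Rightarrow> 'd) set" "UNIV :: 'd set" "\<lambda>b. b x"
        "\<lambda>b. \<Sum>k\<in>UNIV. cnj (\<psi> $ b x) * X $ (b(x := k)) $ b * \<psi> $ k / ?D"]
    by simp
  finally show ?thesis by (simp add: sum_divide_distrib)
qed

text \<open>Supplies the lower bound 0 under which the infimum over inputs is a genuine lower bound.
  Because of the transpose, the value at \<open>\<psi>\<close> is a positive multiple of a sum of
  quadratic forms of \<open>X\<close> at vectors built from the conjugate of
  \<open>\<psi>\<close>.\<close>

lemma Re_expect_ptrace_to_port_epr_resource_nonneg:
  fixes X :: "('n::finite \<Rightarrow> 'd::finite) cmat"
  assumes "psd X"
  shows "0 \<le> Re (expect (ptrace_to_port x (tensor X (mat 1) ** epr_resource)) \<psi>)"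
proof -
  fix z :: 'd
  \<comment> \<open>\<open>v c\<close> is \<open>cnj \<psi>\<close> at port \<open>x\<close>, tensored with the basis string \<open>c\<close> at the other ports; it
    vanishes unless \<open>c x\<close> is the dummy label \<open>z\<close>, so each such string is counted once.\<close>
  define v :: "('n \<Rightarrow> 'd) \<Rightarrow> complex ^ ('n \<Rightarrow> 'd)" where
    "v c = (\<chi> a. if a(x := z) = c then cnj (\<psi> $ a x) else 0)" for c
  define g where "g a b = cnj (\<psi> $ b x) * X $ a $ b * \<psi> $ a x" for a b
  have fibre: "{a. a(x := z) = b(x := z)} = (\<lambda>k. b(x := k)) ` UNIV" for b
  proof (intro equalityI subsetI)
    fix a assume "a \<in> {a. a(x := z) = b(x := z)}"
    then have "a(x := z, x := a x) = b(x := z, x := a x)" by simp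
    then have "a = b(x := a x)" by simp
    then show "a \<in> (\<lambda>k. b(x := k)) ` UNIV" by blast
  qed auto
  have inj: "inj (\<lambda>k. b(x := k))" for b :: "'n \<Rightarrow> 'd"
    by (rule injI) (metis fun_upd_same)
  have "(\<Sum>c\<in>UNIV. expect X (v c)) =
      (\<Sum>c\<in>UNIV. \<Sum>a\<in>UNIV. \<Sum>b\<in>UNIV.
         if b(x := z) = c then if a(x := z) = b(x := z) then g a b else 0 else 0)"
    unfolding expect_eq_sum by (intro sum.cong refl) (auto simp: v_def g_def)
  also have "\<dots> = (\<Sum>a\<in>UNIV. \<Sum>b\<in>UNIV. \<Sum>c\<in>UNIV.
         if b(x := z) = c then if a(x := z) = b(x := z) then g a b else 0 else 0)"
    by (subst sum.swap, rule sum.cong[OF refl], rule sum.swap)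
  \<comment> \<open>For each pair only \<open>c = b(x := z)\<close> survives, which leaves the
    condition that \<open>a\<close> and \<open>b\<close> agree off \<open>x\<close>.\<close>
  also have "\<dots> = (\<Sum>b\<in>UNIV. \<Sum>a\<in>UNIV. if a(x := z) = b(x := z) then g a b else 0)"
    by (simp, rule sum.swap)
  also have "\<dots> = (\<Sum>b\<in>UNIV. \<Sum>a | a(x := z) = b(x := z). g a b)"
    by (simp add: sum.If_cases)
  also have "\<dots> = (\<Sum>b\<in>UNIV. \<Sum>k\<in>UNIV. cnj (\<psi> $ b x) * X $ (b(x := k)) $ b * \<psi> $ k)"
    unfolding fibre by (simp add: sum.reindex[OF inj] g_def)
  finally have "expect (ptrace_to_port x (tensor X (mat 1) ** epr_resource)) \<psi> =
      (\<Sum>c\<in>UNIV. expect X (v c)) / complex_of_real (real CARD('d) ^ CARD('n))"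
    by (simp add: expect_ptrace_to_port_epr_resource)
  then show ?thesis
    by (simp add: Re_divide_of_real psd_Re_expect_nonneg[OF assms] sum_nonneg del: of_real_power)
qed

lemma worst_case_fidelity_le:
  fixes M :: "('n::finite, 'd::finite) strategy"
  assumes "M \<in> pbsp_strategies" "norm \<psi> = 1"
  shows "worst_case_fidelity (pbsp_output M) \<le> Re (expect (pbsp_output M \<psi>) \<psi>)"
  unfolding worst_case_fidelity_def
proof (rule cINF_lower)
  show "bdd_below ((\<lambda>\<psi>. Re (expect (pbsp_output M \<psi>) \<psi>)) ` {\<psi>. norm \<psi> = 1})"
    using assms(1)
    by (auto simp: pbsp_output_def expect_sum pbsp_strategies_def povm_def
        intro!: bdd_belowI[of _ 0] sum_nonneg Re_expect_ptrace_to_port_epr_resource_nonneg)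
qed (use assms in simp)

lemma card_functions_avoiding:
  "card {b :: 'n::finite \<Rightarrow> 'd::finite. \<forall>x. b x \<noteq> z} = (CARD('d) - 1) ^ CARD('n)"
proof -
  \<comment> \<open>Over the domain \<open>UNIV\<close> extensionality is vacuous, so the
    cardinality of extensional function spaces applies.\<close>
  have "{b :: 'n \<Rightarrow> 'd. \<forall>x. b x \<noteq> z} = UNIV \<rightarrow>\<^sub>E (- {z})"
    by (auto simp: PiE_def)
  then show ?thesis by (simp add: card_funcsetE Compl_eq_Diff_UNIV)
qed

lemma fidelity_axis_le:
  fixes M :: "('n::finite, 'd::finite) strategy"
  assumes "M \<in> pbsp_strategies"
  shows "Re (expect (pbsp_output M (axis z 1)) (axis z 1))
    \<le> 1 - (1 - 1 / real CARD('d)) ^ CARD('n)"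
proof -
  define P where "P = M (axis z 1)"
  let ?D = "real CARD('d) ^ CARD('n)"
  have P: "psd (P x)" "(\<Sum>x\<in>UNIV. P x) = mat 1" for x
    using assms by (auto simp: pbsp_strategies_def povm_def P_def)
  have nonneg: "0 \<le> Re (P x $ b $ b)" for x b
    using psd_Re_expect_nonneg[OF P(1), of x "axis b 1"] by (simp add: expect_axis)
  have total: "(\<Sum>x\<in>UNIV. Re (P x $ b $ b)) = 1" for b
  proof -
    have "(\<Sum>x\<in>UNIV. P x $ b $ b) = 1"
      using arg_cong[OF P(2), of "\<lambda>X. X $ b $ b"] by (simp add: mat_def)
    from arg_cong[OF this, of Re] show ?thesis by simp
  qed
  \<comment> \<open>At a basis state only the entry at \<open>z\<close>, \<open>z\<close> matters;
    there \<open>b(x := z) = b\<close>, so just diagonal entries of the measurement remain.\<close>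
  have "expect (pbsp_output M (axis z 1)) (axis z 1) =
      (\<Sum>x\<in>UNIV. \<Sum>b | b x = z. P x $ b $ b) / complex_of_real ?D"
    unfolding expect_axis
    by (simp add: pbsp_output_def P_def ptrace_to_port_epr_resource_nth sum_divide_distrib
        cong: sum.cong) (auto intro!: sum.cong simp: fun_upd_idem)
  then have "Re (expect (pbsp_output M (axis z 1)) (axis z 1)) =
      (\<Sum>x\<in>UNIV. \<Sum>b | b x = z. Re (P x $ b $ b)) / ?D"
    by (simp add: Re_divide_of_real del: of_real_power)
  also have "(\<Sum>x\<in>UNIV. \<Sum>b | b x = z. Re (P x $ b $ b)) =
      (\<Sum>x\<in>UNIV. \<Sum>b\<in>UNIV. if b x = z then Re (P x $ b $ b) else 0)"
    by (simp add: sum.If_cases)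
  also have "\<dots> = (\<Sum>b\<in>UNIV. \<Sum>x\<in>UNIV. if b x = z then Re (P x $ b $ b) else 0)"
    by (rule sum.swap)
  also have "\<dots> \<le> (\<Sum>b\<in>(UNIV :: ('n \<Rightarrow> 'd) set). 1 - (if \<forall>x. b x \<noteq> z then 1 else 0))"
  proof (rule sum_mono)
    fix b :: "'n \<Rightarrow> 'd"
    \<comment> \<open>Discarding ports cannot raise the total 1, and if \<open>z\<close> does not
      occur in \<open>b\<close> every summand is 0.\<close>
    have "(\<Sum>x\<in>UNIV. if b x = z then Re (P x $ b $ b) else 0) \<le> (\<Sum>x\<in>UNIV. Re (P x $ b $ b))"
      by (intro sum_mono) (simp add: nonneg)
    then show "(\<Sum>x\<in>UNIV. if b x = z then Re (P x $ b $ b) else 0)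
        \<le> 1 - (if \<forall>x. b x \<noteq> z then 1 else 0)"
      by (simp add: total)
  qed
  also have "\<dots> = ?D - real (CARD('d) - 1) ^ CARD('n)"
    by (simp add: sum_subtractf sum.If_cases card_functions_avoiding card_fun)
  finally have "Re (expect (pbsp_output M (axis z 1)) (axis z 1))
      \<le> (?D - real (CARD('d) - 1) ^ CARD('n)) / ?D"
    by (simp add: divide_right_mono)
  also have "\<dots> = 1 - (real (CARD('d) - 1) / real CARD('d)) ^ CARD('n)"
    by (simp only: diff_divide_distrib power_divide) simp
  \<comment> \<open>The natural-number difference is not truncated, since a finite type has at least
    one element.\<close>
  also have "real (CARD('d) - 1) / real CARD('d) = 1 - 1 / real CARD('d)"
    by (simp add: of_nat_diff Suc_leI diff_divide_distrib)
  finally show ?thesis .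
qed

theorem theorem5p4:
  assumes "CARD('d::finite) \<ge> 2" and "CARD('n::finite) \<ge> 1"
  shows "optimal_fidelity_epr TYPE('n) TYPE('d) \<le> 1 - (1 - 1 / real CARD('d)) ^ CARD('n)"
  unfolding optimal_fidelity_epr_def
proof (rule cSUP_least[OF pbsp_strategies_nonempty])
  fix M :: "('n, 'd) strategy" and z :: 'd
  assume M: "M \<in> pbsp_strategies"
  \<comment> \<open>Any label \<open>z\<close> serves: the worst case is no better than one basis
    state.\<close>
  have "worst_case_fidelity (pbsp_output M)
      \<le> Re (expect (pbsp_output M (axis z 1)) (axis z 1))"
    by (rule worst_case_fidelity_le[OF M]) (simp add: norm_axis_1)
  also note fidelity_axis_le[OF M]
  finally show "worst_case_fidelity (pbsp_output M) \<le> 1 - (1 - 1 / real CARD('d)) ^ CARD('n)" .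
qed

end
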